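(* Let $N\ge1$, $0<R\le\infty$, let $A$ and $B$ be $C^1$ functions on $(0,R)$ and let $$C(r)=(A(r)B(r))'+(N-1)\frac{A(r)B(r)}{r}-B^2(r).$$ Then for all $\alpha\in\mathbb{R}\setminus\{0\}$ and all $u\in C_0^\infty(B_R\setminus\{0\})$, $$\alpha^2\int_{B_R}A^2(|x|)|\mathcal{R}u|^2dx+\frac1{\alpha^2}\int_{B_R}B^2(|x|)|u|^2dx=\int_{B_R}\left[C(|x|)+B^2(|x|)\right]|u|^2dx+\int_{B_R}\left|\alpha A(|x|)\mathcal{R}u+\frac1\alpha B(|x|)u\right|^2dx$$ and $$\alpha^2\int_{B_R}A^2(|x|)|\nabla u|^2dx+\frac1{\alpha^2}\int_{B_R}B^2(|x|)|u|^2dx=\int_{B_R}\left[C(|x|)+B^2(|x|)\right]|u|^2dx+\int_{B_R}\left|\alpha A(|x|)\nabla u+\frac1\alpha B(|x|)u\frac{x}{|x|}\right|^2dx.$$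
   Context: All functions are real-valued. $B_R$ is the open ball of radius $R$ centered at the origin in $\mathbb{R}^N$ ($B_\infty=\mathbb{R}^N$), and $\mathcal{R}u(x):=\frac{x}{|x|}\cdot\nabla u(x)$ is the radial derivative. *)

theory Defs
  imports "HOL-Analysis.Analysis"
begin

text \<open>The radius may be infinite; the ball of infinite radius is the whole space.\<close>

definition origin_ball :: "ereal \<Rightarrow> 'a::real_normed_vector set" where
  "origin_ball R = {x. ereal (norm x) < R}"

text \<open>Meant for open \<open>S\<close>: derivatives are taken in the whole space at points of \<open>S\<close>.\<close>

primrec Ck_on :: "nat \<Rightarrow> 'a::euclidean_space set \<Rightarrow> ('a \<Rightarrow> real) \<Rightarrow> bool" where
  "Ck_on 0 S f \<longleftrightarrow> continuous_on S f"
| "Ck_on (Suc k) S f \<longleftrightarrow>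
     (\<forall>x\<in>S. f differentiable (at x)) \<and>
     (\<forall>b\<in>Basis. Ck_on k S (\<lambda>x. frechet_derivative f (at x) b))"

text \<open>Smooth functions with compact support in the open set \<open>S\<close>. They are represented by
  their extension by zero to the whole space, and the support is the closure of the
  non-vanishing set in the whole space.\<close>

definition Cc_infinity :: "'a::euclidean_space set \<Rightarrow> ('a \<Rightarrow> real) set" where
  "Cc_infinity S =
     {f. (\<forall>k. Ck_on k S f) \<and> compact (closure {x. f x \<noteq> 0}) \<and> closure {x. f x \<noteq> 0} \<subseteq> S}"

definition grad :: "('a::euclidean_space \<Rightarrow> real) \<Rightarrow> 'a \<Rightarrow> 'a" where
  "grad f x = (\<Sum>b\<in>Basis. frechet_derivative f (at x) b *\<^sub>R b)"

definition radial_deriv :: "('a::euclidean_space \<Rightarrow> real) \<Rightarrow> 'a \<Rightarrow> real" where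
  "radial_deriv f x = (x /\<^sub>R norm x) \<bullet> grad f x"

end

theory Submission
  imports Defs
begin

text \<open>Expanding the squares, both identities reduce to
  \<open>\<integral> (C + B\<^sup>2) u\<^sup>2 + 2 A B u \<R>u = 0\<close>, and this integrand is the divergence of the compactly
  supported field \<open>A B u\<^sup>2 x/|x|\<close>. That a partial derivative of a compactly supported function
  integrates to zero follows from translation invariance of Lebesgue measure, applied to the
  difference quotients, and dominated convergence.\<close>

section \<open>Integrals of derivatives of compactly supported functions\<close>

lemma integrable_lborel_compact_support:
  fixes f :: "'a::euclidean_space \<Rightarrow> real"
  assumes "compact K" "continuous_on K f" "\<And>x. x \<notin> K \<Longrightarrow> f x = 0"
  shows "integrable lborel f"
proof -
  have "(\<lambda>x. indicator K x *\<^sub>R f x) = f"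
    using assms(3) by (auto simp: fun_eq_iff indicator_def)
  then show ?thesis
    using borel_integrable_compact[OF assms(1,2)] by simp
qed

text \<open>The complement of \<open>K\<close> is open, so \<open>f\<close> coincides with 0 near
  \<open>x\<close>. This gives differentiability off the support, whatever the formula for
  \<open>f\<close> does there.\<close>

lemma has_derivative_zero_outside_closed:
  assumes "closed K" "\<And>y. y \<notin> K \<Longrightarrow> f y = 0" "x \<notin> K"
  shows "(f has_derivative (\<lambda>v. 0)) (at x)"
  by (rule has_derivative_transform_within_open[where f="\<lambda>_. 0" and s="- K"])
     (use assms in auto)

lemma integral_lborel_translate:
  fixes f :: "'a::euclidean_space \<Rightarrow> real"
  assumes "f \<in> borel_measurable borel"
  shows "(LINT x|lborel. f (c + x)) = (LINT x|lborel. f x)"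
proof -
  have "(LINT x|lborel. f x) = (LINT x|distr lborel borel ((+) c). f x)"
    by (simp add: lborel_distr_plus)
  also have "\<dots> = (LINT x|lborel. f (c + x))"
    using assms by (subst integral_distr) auto
  finally show ?thesis by simp
qed

text \<open>Continuity of the derivative along \<open>b\<close> is asked only on \<open>K\<close>:
  off \<open>K\<close> this derivative is 0, because \<open>f\<close> vanishes near every such
  point.\<close>

lemma integral_directional_derivative_eq_0:
  fixes f :: "'a::euclidean_space \<Rightarrow> real"
  assumes K: "compact K" and f0: "\<And>x. x \<notin> K \<Longrightarrow> f x = 0"
    and df: "\<And>x. (f has_derivative f' x) (at x)"
    and cont: "continuous_on K (\<lambda>x. f' x b)"
  shows "(LINT x|lborel. f' x b) = 0"
proof -
  have f'0: "f' x b = 0" if "x \<notin> K" for x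
    using has_derivative_unique[OF df has_derivative_zero_outside_closed[OF compact_imp_closed[OF K] f0 that]]
    by simp
  have contf: "continuous_on UNIV f"
    using df by (meson continuous_at_imp_continuous_on has_derivative_continuous)
  then have mf[measurable]: "f \<in> borel_measurable borel"
    by (rule borel_measurable_continuous_onI)
  have intf: "integrable lborel f"
    using K f0 contf by (blast intro: integrable_lborel_compact_support continuous_on_subset)
  have intf': "integrable lborel (\<lambda>x. f' x b)"
    using K cont f'0 by (rule integrable_lborel_compact_support)
  obtain M0 where "\<And>x. x \<in> K \<Longrightarrow> norm (f' x b) \<le> M0"
    using compact_imp_bounded[OF compact_continuous_image[OF cont K]]
    by (auto simp: bounded_iff)
  \<comment> \<open>Taking the maximum with 0 extends the bound to points off \<open>K\<close>,
    where the derivative is 0, and also covers an empty \<open>K\<close>.\<close>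
  then obtain M where M: "\<And>x. \<bar>f' x b\<bar> \<le> M" and "0 \<le> M"
    using f'0 by (metis abs_ge_zero abs_zero max.cobounded2 max.coboundedI1 real_norm_def)
  obtain r where r: "\<And>x. x \<in> K \<Longrightarrow> norm x \<le> r"
    using compact_imp_bounded[OF K] by (auto simp: bounded_iff)
  have line: "((\<lambda>t. f (t *\<^sub>R b + x)) has_field_derivative f' (t *\<^sub>R b + x) b) (at t)" for x t
  proof -
    have "((\<lambda>t. t *\<^sub>R b + x) has_derivative (\<lambda>t. t *\<^sub>R b)) (at t)"
      by (auto intro!: derivative_eq_intros)
    then have "((\<lambda>t. f (t *\<^sub>R b + x)) has_derivative (\<lambda>s. f' (t *\<^sub>R b + x) (s *\<^sub>R b))) (at t)"
      using df by (rule has_derivative_compose)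
    moreover have "(\<lambda>s. f' (t *\<^sub>R b + x) (s *\<^sub>R b)) = (*) (f' (t *\<^sub>R b + x) b)"
      using has_derivative_linear[OF df] by (auto simp: linear_scale)
    ultimately show ?thesis
      by (simp add: has_field_derivative_def)
  qed
  \<comment> \<open>The steps lie in (0,1], so a translation by \<open>h n *\<^sub>R b\<close> moves
    a point by at most \<open>norm b\<close>.\<close>
  define h where "h n = inverse (real (Suc n))" for n
  have h: "0 < h n" "h n \<le> 1" for n
    by (auto simp: h_def field_simps)
  have h_lim: "h \<longlonglongrightarrow> 0"
    unfolding h_def by (rule LIMSEQ_inverse_real_of_nat)
  define q where "q n x = (f (h n *\<^sub>R b + x) - f x) / h n" for n x
  have "(\<lambda>n. LINT x|lborel. q n x) \<longlonglongrightarrow> (LINT x|lborel. f' x b)"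
  \<comment> \<open>All quotients \<open>q n\<close> are dominated by \<open>M\<close> on one fixed
    ball: \<open>K\<close> has radius at most \<open>r\<close>, and the translations enlarge it by
    at most \<open>norm b\<close>.\<close>
  proof (rule integral_dominated_convergence[where w="\<lambda>x. indicator (cball 0 (r + norm b)) x * M"])
    show "(\<lambda>x. f' x b) \<in> borel_measurable lborel"
      using intf' by (rule borel_measurable_integrable)
    show "q n \<in> borel_measurable lborel" for n
      unfolding q_def by measurable
    show "integrable lborel (\<lambda>x::'a. indicator (cball 0 (r + norm b)) x * M)"
      using borel_integrable_compact[of "cball (0::'a) (r + norm b)" "\<lambda>_. M"] by simp
    show "AE x in lborel. (\<lambda>n. q n x) \<longlonglongrightarrow> f' x b"
    proof (rule AE_I2)
      fix x
      have "((\<lambda>t. (f (t *\<^sub>R b + x) - f x) / t) \<longlongrightarrow> f' x b) (at 0)"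
        using line[of x 0] by (simp add: DERIV_def)
      moreover have "filterlim h (at 0) sequentially"
        using h_lim h(1) by (auto simp: filterlim_at eventually_sequentially intro!: exI[of _ 0] less_imp_neq[THEN not_sym])
      ultimately show "(\<lambda>n. q n x) \<longlonglongrightarrow> f' x b"
        unfolding q_def by (rule filterlim_compose)
    qed
    show "AE x in lborel. norm (q n x) \<le> indicator (cball 0 (r + norm b)) x * M" for n
    proof (rule AE_I2)
      fix x
      \<comment> \<open>The mean value theorem on the segment from \<open>x\<close> to
        \<open>h n *\<^sub>R b + x\<close> makes the bound \<open>M\<close> on the derivative a
        bound on the quotient, uniformly in \<open>n\<close>.\<close>
      from MVT2[OF h(1)[of n] line[of x]] obtain z
        where "f (h n *\<^sub>R b + x) - f x = h n * f' (z *\<^sub>R b + x) b" by auto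
      then have "\<bar>q n x\<bar> \<le> M"
        using M h(1)[of n] by (simp add: q_def)
      \<comment> \<open>Far out, both \<open>x\<close> and its translate have norm above
        \<open>r\<close>, so both values of \<open>f\<close> are 0.\<close>
      moreover have "q n x = 0" if "x \<notin> cball 0 (r + norm b)"
      proof -
        have x: "r + norm b < norm x" using that by simp
        have "norm (h n *\<^sub>R b) \<le> norm b"
          using h[of n] by (simp add: mult_left_le_one_le)
        moreover have "norm x \<le> norm (h n *\<^sub>R b + x) + norm (h n *\<^sub>R b)"
          by (metis add_diff_cancel_left' norm_triangle_sub norm_triangle_ineq4 add.commute)
        ultimately have "r < norm (h n *\<^sub>R b + x)" "r < norm x"
          using x norm_ge_zero[of b] by linarith+
        then have "h n *\<^sub>R b + x \<notin> K" "x \<notin> K"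
          using r leD by blast+
        then show ?thesis
          by (simp add: q_def f0)
      qed
      ultimately show "norm (q n x) \<le> indicator (cball 0 (r + norm b)) x * M"
        by (auto simp: indicator_def)
    qed
  qed
  moreover have "(LINT x|lborel. q n x) = 0" for n
  proof -
    \<comment> \<open>Integrability of the translate lets the integral of the difference split into
      two integrals, which are equal by translation invariance.\<close>
    have "integrable lborel (\<lambda>x. f (h n *\<^sub>R b + x))"
      using intf integrable_distr_eq[of "(+) (h n *\<^sub>R b)" lborel borel f]
      by (simp add: lborel_distr_plus)
    then show ?thesis
      using intf by (simp add: q_def integral_lborel_translate)
  qed
  ultimately show ?thesis
    by (simp add: LIMSEQ_const_iff)
qed

section \<open>Gradients and the divergence theorem\<close>

lemma frechet_derivative_eq_inner_grad:
  assumes "f differentiable (at x)"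
  shows "frechet_derivative f (at x) v = grad f x \<bullet> v"
proof -
  have lin: "linear (frechet_derivative f (at x))"
    using assms by (rule linear_frechet_derivative)
  have "frechet_derivative f (at x) v = frechet_derivative f (at x) (\<Sum>b\<in>Basis. (v \<bullet> b) *\<^sub>R b)"
    by (simp add: euclidean_representation)
  also have "\<dots> = grad f x \<bullet> v"
    by (simp add: linear_sum[OF lin] linear_scale[OF lin] grad_def inner_sum_right inner_commute[of _ v]
        mult.commute)
  finally show ?thesis .
qed

text \<open>The divergence theorem for the field \<open>g(x) x\<close>.\<close>

lemma integral_div_radial_eq_0:
  fixes g :: "'a::euclidean_space \<Rightarrow> real"
  assumes K: "compact K" and g0: "\<And>x. x \<notin> K \<Longrightarrow> g x = 0"
    and dg: "\<And>x. (g has_derivative (\<lambda>v. G x \<bullet> v)) (at x)"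
    and cont: "continuous_on K G"
  shows "(LINT x|lborel. G x \<bullet> x + real DIM('a) * g x) = 0"
proof -
  \<comment> \<open>\<open>?f' b x\<close> is the full derivative at \<open>x\<close> of the
    component \<open>g x * (x \<bullet> b)\<close> of the field; evaluated at \<open>b\<close> it is
    the diagonal entry that enters the divergence.\<close>
  let ?f' = "\<lambda>b x v. (G x \<bullet> v) * (x \<bullet> b) + g x * (v \<bullet> b)"
  have contg: "continuous_on K g"
    using dg by (meson continuous_at_imp_continuous_on has_derivative_continuous)
  have G0: "G x = 0" if "x \<notin> K" for x
  proof -
    have "(\<lambda>v. G x \<bullet> v) = (\<lambda>v. 0)"
      using has_derivative_unique[OF dg has_derivative_zero_outside_closed[OF compact_imp_closed[OF K] g0 that]] .
    then show ?thesis by (metis inner_eq_zero_iff)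
  qed
  have cont': "continuous_on K (\<lambda>x. ?f' b x b)" for b
    by (intro continuous_intros cont contg)
  have int: "integrable lborel (\<lambda>x. ?f' b x b)" for b
    using K cont' by (rule integrable_lborel_compact_support) (simp add: g0 G0)
  have zero: "(LINT x|lborel. ?f' b x b) = 0" for b
  proof (rule integral_directional_derivative_eq_0[OF K, where f="\<lambda>x. g x * (x \<bullet> b)" and f'="?f' b"])
    show "((\<lambda>x. g x * (x \<bullet> b)) has_derivative ?f' b x) (at x)" for x
      by (auto intro!: derivative_eq_intros dg simp: fun_eq_iff)
  qed (use g0 cont' in auto)
  \<comment> \<open>Summed over the basis, the first terms give \<open>G x \<bullet> x\<close>; each
    second term is \<open>g x\<close> because \<open>b \<bullet> b = 1\<close>, hence the factor
    \<open>DIM('a)\<close>.\<close>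
  have "G x \<bullet> x + real DIM('a) * g x = (\<Sum>b\<in>Basis. ?f' b x b)" for x
  proof -
    have "G x \<bullet> x = (\<Sum>b\<in>Basis. (G x \<bullet> b) * (x \<bullet> b))"
      by (rule euclidean_inner)
    then show ?thesis
      by (simp add: sum.distrib inner_Basis)
  qed
  then have "(LINT x|lborel. G x \<bullet> x + real DIM('a) * g x) = (LINT x|lborel. (\<Sum>b\<in>Basis. ?f' b x b))"
    by presburger
  also have "\<dots> = (\<Sum>b\<in>Basis. LINT x|lborel. ?f' b x b)"
    using int by (rule Bochner_Integration.integral_sum)
  also have "\<dots> = 0"
    by (simp only: zero sum.neutral_const)
  finally show ?thesis .
qed

theorem lemma2p1:
  fixes R :: ereal and A B C :: "real \<Rightarrow> real"
    and \<alpha> :: real and u :: "real ^ 'n \<Rightarrow> real"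
  assumes "0 < R"
    and "A C1_differentiable_on {r. 0 < r \<and> ereal r < R}"
    and "B C1_differentiable_on {r. 0 < r \<and> ereal r < R}"
    and "\<And>r. 0 < r \<Longrightarrow> ereal r < R \<Longrightarrow>
           C r = deriv (\<lambda>s. A s * B s) r + (real CARD('n) - 1) * (A r * B r / r) - (B r)\<^sup>2"
    and "\<alpha> \<noteq> 0"
    and "u \<in> Cc_infinity (origin_ball R - {0})"
  shows "\<alpha>\<^sup>2 * (LINT x:origin_ball R|lborel. (A (norm x))\<^sup>2 * \<bar>radial_deriv u x\<bar>\<^sup>2)
           + 1 / \<alpha>\<^sup>2 * (LINT x:origin_ball R|lborel. (B (norm x))\<^sup>2 * \<bar>u x\<bar>\<^sup>2)
         = (LINT x:origin_ball R|lborel. (C (norm x) + (B (norm x))\<^sup>2) * \<bar>u x\<bar>\<^sup>2)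
           + (LINT x:origin_ball R|lborel.
                \<bar>\<alpha> * A (norm x) * radial_deriv u x + 1 / \<alpha> * B (norm x) * u x\<bar>\<^sup>2)
         \<and>
         \<alpha>\<^sup>2 * (LINT x:origin_ball R|lborel. (A (norm x))\<^sup>2 * (norm (grad u x))\<^sup>2)
           + 1 / \<alpha>\<^sup>2 * (LINT x:origin_ball R|lborel. (B (norm x))\<^sup>2 * \<bar>u x\<bar>\<^sup>2)
         = (LINT x:origin_ball R|lborel. (C (norm x) + (B (norm x))\<^sup>2) * \<bar>u x\<bar>\<^sup>2)
           + (LINT x:origin_ball R|lborel.
                (norm ((\<alpha> * A (norm x)) *\<^sub>R grad u x
                       + (1 / \<alpha> * B (norm x) * u x) *\<^sub>R (x /\<^sub>R norm x)))\<^sup>2)"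
proof -

  \<comment> \<open>Support and regularity of the data\<close>
  let ?S = "origin_ball R - {0} :: (real ^ 'n) set"
  define K where "K = closure {x. u x \<noteq> 0}"
  define I where "I = {r. 0 < r \<and> ereal r < R}"
  have K: "compact K" and KS: "K \<subseteq> ?S" and Ck: "Ck_on (Suc 0) ?S u"
    using assms(6) by (auto simp: Cc_infinity_def K_def)
  have u0: "u x = 0" if "x \<notin> K" for x
    using that closure_subset[of "{x. u x \<noteq> 0}"] by (auto simp: K_def)
  \<comment> \<open>The support avoids the origin, so on \<open>K\<close> the coefficients are
    regular and division by \<open>norm x\<close> is harmless.\<close>
  have K_I: "norm x \<in> I" "x \<noteq> 0" if "x \<in> K" for x
    using that KS by (auto simp: I_def origin_ball_def)
  \<comment> \<open>Smoothness is given on the punctured ball only; elsewhere, the origin included,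
    \<open>u\<close> is locally 0. Thus \<open>u\<close> is differentiable on the whole
    space.\<close>
  have diff_u: "u differentiable (at x)" for x
  proof (cases "x \<in> K")
    case True
    then show ?thesis using Ck KS by auto
  next
    case False
    then show ?thesis
      using has_derivative_zero_outside_closed[of K u, OF compact_imp_closed[OF K] u0]
      unfolding differentiable_def by blast
  qed
  have du: "(u has_derivative (\<lambda>v. grad u x \<bullet> v)) (at x)" for x
    using diff_u[of x] frechet_derivative_eq_inner_grad[OF diff_u[of x], abs_def] by (simp add: frechet_derivative_works)
  have grad0: "grad u x = 0" if "x \<notin> K" for x
  proof -
    have "(\<lambda>v. grad u x \<bullet> v) = (\<lambda>v. 0)"
      using has_derivative_unique[OF du has_derivative_zero_outside_closed[of K u, OF compact_imp_closed[OF K] u0 that]] .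
    then show ?thesis by (metis inner_eq_zero_iff)
  qed
  have cu[continuous_intros]: "continuous_on K u"
    using du by (meson continuous_at_imp_continuous_on has_derivative_continuous)
  have cgrad[continuous_intros]: "continuous_on K (grad u)"
    unfolding grad_def
    by (intro continuous_intros continuous_on_subset[OF _ KS]) (use Ck in auto)
  have cradial[continuous_intros]: "continuous_on K (radial_deriv u)"
    unfolding radial_deriv_def by (intro continuous_intros) (use K_I in auto)
  have radial0: "radial_deriv u x = 0" if "x \<notin> K" for x
    using that by (simp add: radial_deriv_def grad0)
  obtain DA where DA: "\<And>r. r \<in> I \<Longrightarrow> (A has_vector_derivative DA r) (at r)" "continuous_on I DA"
    using assms(2) by (auto simp: C1_differentiable_on_def I_def)
  obtain DB where DB: "\<And>r. r \<in> I \<Longrightarrow> (B has_vector_derivative DB r) (at r)" "continuous_on I DB"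
    using assms(3) by (auto simp: C1_differentiable_on_def I_def)
  have norm_comp: "continuous_on K (\<lambda>x. f (norm x))" if "continuous_on I f" for f :: "real \<Rightarrow> real"
    by (rule continuous_on_compose2[OF that]) (use K_I in \<open>auto intro: continuous_intros\<close>)
  have cI: "continuous_on I A" "continuous_on I B"
    using DA DB by (meson continuous_at_imp_continuous_on has_vector_derivative_continuous)+
  note norm_comp[OF cI(1), continuous_intros] norm_comp[OF cI(2), continuous_intros]
    norm_comp[OF DA(2), continuous_intros] norm_comp[OF DB(2), continuous_intros]
  define dh where "dh r = DA r * B r + A r * DB r" for r
  have dAB: "((\<lambda>s. A s * B s) has_field_derivative dh r) (at r)" if "r \<in> I" for r
    using DA(1)[OF that] DB(1)[OF that] unfolding has_real_derivative_iff_has_vector_derivative[symmetric] dh_def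
    by (auto intro!: derivative_eq_intros)
  \<comment> \<open>Adding \<open>(B r)\<^sup>2\<close> cancels the last term of \<open>C\<close>;
    what remains is the divergence of the field \<open>A B x/|x|\<close> at radius
    \<open>r\<close>.\<close>
  have C_eq: "C r + (B r)\<^sup>2 = dh r + (real CARD('n) - 1) * (A r * B r / r)" if "r \<in> I" for r
    using assms(4)[of r] that DERIV_imp_deriv[OF dAB[OF that]] by (simp add: I_def)

  \<comment> \<open>\<open>X\<close> is the cross term common to both expanded squares, and
    \<open>T\<close> is the term to be cancelled against it. \<open>P\<close>, \<open>P'\<close> and
    \<open>Q\<close> are the square terms without their powers of \<alpha>.\<close>
  define T where "T x = (C (norm x) + (B (norm x))\<^sup>2) * \<bar>u x\<bar>\<^sup>2" for x
  define X where "X x = 2 * A (norm x) * B (norm x) * u x * radial_deriv u x" for x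
  define Q where "Q x = (B (norm x))\<^sup>2 * \<bar>u x\<bar>\<^sup>2" for x
  define P where "P x = (A (norm x))\<^sup>2 * \<bar>radial_deriv u x\<bar>\<^sup>2" for x
  define P' where "P' x = (A (norm x))\<^sup>2 * (norm (grad u x))\<^sup>2" for x
  have T_eq: "T x = (dh (norm x) + (real CARD('n) - 1) * (A (norm x) * B (norm x) / norm x)) * \<bar>u x\<bar>\<^sup>2"
    if "x \<in> K" for x
    using C_eq[OF K_I(1)[OF that]] by (simp add: T_def)
  \<comment> \<open>\<open>C\<close> is known only through its equation on \<open>I\<close>, so
    continuity of \<open>T\<close> on \<open>K\<close> is read off from \<open>T_eq\<close>.\<close>
  have iT: "integrable lborel T"
  proof (rule integrable_lborel_compact_support[OF K])
    have "continuous_on K (\<lambda>x. (dh (norm x) + (real CARD('n) - 1) *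
        (A (norm x) * B (norm x) / norm x)) * \<bar>u x\<bar>\<^sup>2)"
      unfolding dh_def by (intro continuous_intros) (use K_I in auto)
    then show "continuous_on K T"
      by (rule continuous_on_eq) (simp add: T_eq)
  qed (simp add: T_def u0)
  have iX: "integrable lborel X" unfolding X_def
    by (rule integrable_lborel_compact_support[OF K]) (auto simp: u0 intro!: continuous_intros)
  have iQ: "integrable lborel Q" unfolding Q_def
    by (rule integrable_lborel_compact_support[OF K]) (auto simp: u0 intro!: continuous_intros)
  have iP: "integrable lborel P" unfolding P_def
    by (rule integrable_lborel_compact_support[OF K]) (auto simp: radial0 intro!: continuous_intros)
  have iP': "integrable lborel P'" unfolding P'_def
    by (rule integrable_lborel_compact_support[OF K]) (auto simp: grad0 intro!: continuous_intros)

  \<comment> \<open>The divergence identity\<close>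
  have TX: "(LINT x|lborel. T x + X x) = 0"
  proof -
    \<comment> \<open>Dividing by \<open>norm x\<close> writes the field
      \<open>A B u^2 x/|x|\<close> as \<open>g x *\<^sub>R x\<close>, the form the divergence
      theorem above expects.\<close>
    define g where "g x = A (norm x) * B (norm x) / norm x * (u x)\<^sup>2" for x
    define c where "c x = (dh (norm x) / norm x - A (norm x) * B (norm x) / (norm x)\<^sup>2)
        * (u x)\<^sup>2 / norm x" for x
    \<comment> \<open>\<open>G\<close> is the gradient of \<open>g\<close>:
      \<open>c x *\<^sub>R x\<close> comes from differentiating \<open>A B / r\<close> in the
      direction \<open>x/|x|\<close>, the other summand from \<open>u^2\<close>.\<close>
    define G where "G x = c x *\<^sub>R x + (2 * (A (norm x) * B (norm x) / norm x) * u x) *\<^sub>R grad u x" for x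
    have dg: "(g has_derivative (\<lambda>v. G x \<bullet> v)) (at x)" for x
    proof (cases "x \<in> K")
      case True
      note x = K_I[OF True]
      have "((\<lambda>s. A s * B s / s) has_field_derivative
          (dh (norm x) / norm x - A (norm x) * B (norm x) / (norm x)\<^sup>2)) (at (norm x))"
        using x(2) by (intro DERIV_cong[OF DERIV_divide[OF dAB[OF x(1)] DERIV_ident]])
          (auto simp: field_simps power2_eq_square)
      moreover have "(norm has_derivative (\<lambda>v. sgn x \<bullet> v)) (at x)"
        using has_derivative_norm[OF x(2)] by (simp add: inner_commute)
      ultimately have "((\<lambda>x. A (norm x) * B (norm x) / norm x) has_derivative
          (\<lambda>v. (dh (norm x) / norm x - A (norm x) * B (norm x) / (norm x)\<^sup>2) * (sgn x \<bullet> v))) (at x)"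
        unfolding has_field_derivative_def by (rule has_derivative_compose[rotated])
      then have "(g has_derivative (\<lambda>v. A (norm x) * B (norm x) / norm x * (2 * u x * (grad u x \<bullet> v))
          + (dh (norm x) / norm x - A (norm x) * B (norm x) / (norm x)\<^sup>2) * (sgn x \<bullet> v) * (u x)\<^sup>2)) (at x)"
        unfolding g_def by (rule has_derivative_mult) (auto intro!: derivative_eq_intros du)
      moreover have "A (norm x) * B (norm x) / norm x * (2 * u x * (grad u x \<bullet> v))
          + (dh (norm x) / norm x - A (norm x) * B (norm x) / (norm x)\<^sup>2) * (sgn x \<bullet> v) * (u x)\<^sup>2
          = G x \<bullet> v" for v
        by (simp add: G_def c_def sgn_div_norm inner_add_left divide_inverse)
      ultimately show ?thesis by simp
    next
      case False
      then have "G x = 0" by (simp add: G_def c_def u0)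
      then show ?thesis
        using has_derivative_zero_outside_closed[OF compact_imp_closed[OF K] _ False, of g]
        by (simp add: g_def u0)
    qed
    have "continuous_on K G"
      unfolding G_def c_def dh_def by (intro continuous_intros) (use K_I in auto)
    then have "(LINT x|lborel. G x \<bullet> x + real DIM(real^'n) * g x) = 0"
      by (intro integral_div_radial_eq_0[OF K _ dg]) (simp_all add: g_def u0)
    \<comment> \<open>With \<open>r = norm x\<close>, \<open>G x \<bullet> x\<close> equals
      \<open>dh r * u^2 - A B u^2 / r + X x\<close>. Adding N times \<open>g x = A B u^2 / r\<close>
      turns the coefficient -1 into N - 1, which is that in \<open>T_eq\<close>.\<close>
    moreover have "G x \<bullet> x + real DIM(real^'n) * g x = T x + X x" for x
    proof (cases "x \<in> K")
      case True
      have "0 < norm x" using K_I[OF True] by simp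
      have "grad u x \<bullet> x = radial_deriv u x * norm x"
        using \<open>0 < norm x\<close> by (simp add: radial_deriv_def inner_commute divide_inverse)
      moreover have "x \<bullet> x = (norm x)\<^sup>2" by (simp add: dot_square_norm)
      ultimately show ?thesis
        using \<open>0 < norm x\<close>
        by (simp add: G_def c_def g_def T_eq[OF True] X_def inner_add_left field_simps power2_eq_square)
    next
      case False
      then show ?thesis by (simp add: G_def c_def g_def T_def X_def u0)
    qed
    ultimately show ?thesis by simp
  qed
  then have TX': "integral\<^sup>L lborel T + integral\<^sup>L lborel X = 0"
    using iT iX by simp

  \<comment> \<open>Expanding the squares and assembling both identities\<close>
  have sq: "\<bar>\<alpha> * A (norm x) * radial_deriv u x + 1 / \<alpha> * B (norm x) * u x\<bar>\<^sup>2
      = \<alpha>\<^sup>2 * P x + 1 / \<alpha>\<^sup>2 * Q x + X x" for x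
    using assms(5) by (simp add: P_def Q_def X_def field_simps power2_eq_square)
  \<comment> \<open>The inner product of \<open>grad u x\<close> with \<open>x/|x|\<close> is the
    radial derivative, so the cross term is again \<open>X\<close>. The unit length of
    \<open>x/|x|\<close> fails at the origin, but off \<open>K\<close> both sides vanish.\<close>
  have sq': "(norm ((\<alpha> * A (norm x)) *\<^sub>R grad u x + (1 / \<alpha> * B (norm x) * u x) *\<^sub>R (x /\<^sub>R norm x)))\<^sup>2
      = \<alpha>\<^sup>2 * P' x + 1 / \<alpha>\<^sup>2 * Q x + X x" for x
  proof (cases "x \<in> K")
    case True
    let ?e = "x /\<^sub>R norm x"
    have e: "?e \<bullet> ?e = 1"
      using K_I(2)[OF True] by (simp add: dot_square_norm power2_eq_square)
    have "(norm (a *\<^sub>R grad u x + b *\<^sub>R ?e))\<^sup>2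
        = a\<^sup>2 * (norm (grad u x))\<^sup>2 + b\<^sup>2 * (?e \<bullet> ?e) + 2 * a * b * (?e \<bullet> grad u x)" for a b
      unfolding power2_norm_eq_inner
      by (simp add: inner_add_left inner_add_right inner_commute algebra_simps power2_eq_square)
    from this[of "\<alpha> * A (norm x)" "1 / \<alpha> * B (norm x) * u x", unfolded e] show ?thesis
      using assms(5)
      by (simp add: P'_def Q_def X_def radial_deriv_def[of u x] field_simps power2_eq_square)
  next
    case False
    then show ?thesis by (simp add: P'_def Q_def X_def u0 grad0)
  qed
  \<comment> \<open>\<open>K\<close> lies in the ball, so an integrand vanishing off
    \<open>K\<close> has the same integral over the ball and over the whole space.\<close>
  have set_int: "(LINT x:origin_ball R|lborel. f x) = (LINT x|lborel. f x)"
    if "\<And>x. x \<notin> K \<Longrightarrow> f x = 0" for f :: "real^'n \<Rightarrow> real"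
  proof -
    have "(\<lambda>x. indicator (origin_ball R) x *\<^sub>R f x) = f"
      using that KS by (fastforce simp: indicator_def)
    then show ?thesis by (simp add: set_lebesgue_integral_def)
  qed
  have zero: "T x = 0" "X x = 0" "Q x = 0" "P x = 0" "P' x = 0" if "x \<notin> K" for x
    using that by (simp_all add: T_def X_def Q_def P_def P'_def u0 grad0 radial0)
  have T: "(LINT x:origin_ball R|lborel. (C (norm x) + (B (norm x))\<^sup>2) * \<bar>u x\<bar>\<^sup>2) = integral\<^sup>L lborel T"
    unfolding T_def[symmetric] by (rule set_int) (rule zero)
  have Q: "(LINT x:origin_ball R|lborel. (B (norm x))\<^sup>2 * \<bar>u x\<bar>\<^sup>2) = integral\<^sup>L lborel Q"
    unfolding Q_def[symmetric] by (rule set_int) (rule zero)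
  have P: "(LINT x:origin_ball R|lborel. (A (norm x))\<^sup>2 * \<bar>radial_deriv u x\<bar>\<^sup>2) = integral\<^sup>L lborel P"
    unfolding P_def[symmetric] by (rule set_int) (rule zero)
  have P': "(LINT x:origin_ball R|lborel. (A (norm x))\<^sup>2 * (norm (grad u x))\<^sup>2) = integral\<^sup>L lborel P'"
    unfolding P'_def[symmetric] by (rule set_int) (rule zero)
  have "(LINT x:origin_ball R|lborel. \<alpha>\<^sup>2 * P x + 1 / \<alpha>\<^sup>2 * Q x + X x)
      = \<alpha>\<^sup>2 * integral\<^sup>L lborel P + 1 / \<alpha>\<^sup>2 * integral\<^sup>L lborel Q + integral\<^sup>L lborel X"
    using iP iQ iX by (subst set_int) (simp_all add: zero)
  moreover have "(LINT x:origin_ball R|lborel. \<alpha>\<^sup>2 * P' x + 1 / \<alpha>\<^sup>2 * Q x + X x)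
      = \<alpha>\<^sup>2 * integral\<^sup>L lborel P' + 1 / \<alpha>\<^sup>2 * integral\<^sup>L lborel Q + integral\<^sup>L lborel X"
    using iP' iQ iX by (subst set_int) (simp_all add: zero)
  \<comment> \<open>On each right-hand side the integrals of \<open>T\<close> and \<open>X\<close>
    cancel by \<open>TX'\<close>, leaving exactly the left-hand side.\<close>
  ultimately show ?thesis
    unfolding sq sq' T Q P P' using TX' by simp
qed

end
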